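(* Let $n,q,p$ be positive integers with $2\le q\le n-1$ and $\left\lfloor\frac{n(q-1)}{q}\right\rfloor\le p\le n-1$. Then $b(H_{n,q}^p)\ge q^{n-1}$.
   Context: For $q\ge 2$, the Hamming graph $H_{n,q}$ has vertex set $\mathbb{Z}_q^n$, two $n$-tuples being adjacent iff they differ in exactly one coordinate; its graph distance between two tuples is the number of coordinates in which they differ. The $p$-th power $G^p$ of a graph $G$ has vertex set $V(G)$, with distinct $x,y$ adjacent iff $d_G(x,y)\le p$. A b-coloring of a graph $G$ with $k$ colors is a proper vertex coloring with $k$ colors in which every color class contains a vertex adjacent to at least one vertex of every other color class; the b-chromatic number $b(G)$ is the largest $k$ for which $G$ has a b-coloring with $k$ colors. *)

theory Defs
  imports "Graph_Theory.Graph_Theory" "HOL-Library.FuncSet"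
begin

text \<open>
  A simple graph is a \<^typ>\<open>'a pair_pre_digraph\<close> satisfying \<^locale>\<open>pair_graph\<close>: a finite,
  irreflexive and symmetric arc relation. Each edge is stored as a pair of opposite arcs.
\<close>

text \<open>
  The least number of edges of a walk, namely the shortest-path weight for unit arc weights;
  it is infinite if there is no walk.
\<close>

definition graph_dist :: "'a pair_pre_digraph \<Rightarrow> 'a \<Rightarrow> 'a \<Rightarrow> ereal" where
  "graph_dist G x y = wf_digraph.\<mu> (with_proj G) (\<lambda>_. 1) x y"

definition graph_power :: "'a pair_pre_digraph \<Rightarrow> nat \<Rightarrow> 'a pair_pre_digraph" where
  "graph_power G p =
     \<lparr> pverts = pverts G,
       parcs = {(x, y). x \<in> pverts G \<and> y \<in> pverts G \<and> x \<noteq> y \<and> graph_dist G x y \<le> ereal (real p)} \<rparr>"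

text \<open>
  The tuples in \<open>\<int>\<^sub>q\<^sup>n\<close> are the extensional functions from \<open>{..<n}\<close> to \<open>{..<q}\<close>; the group
  structure plays no role.
\<close>

definition hamming_graph :: "nat \<Rightarrow> nat \<Rightarrow> (nat \<Rightarrow> nat) pair_pre_digraph" where
  "hamming_graph n q =
     \<lparr> pverts = {..<n} \<rightarrow>\<^sub>E {..<q},
       parcs = {(x, y). x \<in> {..<n} \<rightarrow>\<^sub>E {..<q} \<and> y \<in> {..<n} \<rightarrow>\<^sub>E {..<q} \<and>
                        card {i. i < n \<and> x i \<noteq> y i} = 1} \<rparr>"

definition proper_coloring :: "'a pair_pre_digraph \<Rightarrow> nat \<Rightarrow> ('a \<Rightarrow> nat) \<Rightarrow> bool" where
  "proper_coloring G k c \<longleftrightarrow>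
     c \<in> pverts G \<rightarrow> {..<k} \<and> (\<forall>(u, v) \<in> parcs G. c u \<noteq> c v)"

text \<open>The second conjunct also makes all \<open>k\<close> color classes nonempty.\<close>

definition b_coloring :: "'a pair_pre_digraph \<Rightarrow> nat \<Rightarrow> ('a \<Rightarrow> nat) \<Rightarrow> bool" where
  "b_coloring G k c \<longleftrightarrow>
     proper_coloring G k c \<and>
     (\<forall>i<k. \<exists>u\<in>pverts G. c u = i \<and>
        (\<forall>j<k. j \<noteq> i \<longrightarrow> (\<exists>v. (u, v) \<in> parcs G \<and> c v = j)))"

text \<open>For finite graphs; the maximum is over a finite set by \<open>finite_b_coloring_numbers\<close>.\<close>

definition b_chromatic_number :: "'a pair_pre_digraph \<Rightarrow> nat" where
  "b_chromatic_number G = Max {k. \<exists>c. b_coloring G k c}"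

lemma b_coloring_card_le:
  assumes "finite (pverts G)" "b_coloring G k c"
  shows "k \<le> card (pverts G)"
proof -
  have "{..<k} \<subseteq> c ` pverts G"
  proof
    fix i assume "i \<in> {..<k}"
    then obtain u where "u \<in> pverts G" "c u = i"
      using assms(2) unfolding b_coloring_def by (meson lessThan_iff)
    then show "i \<in> c ` pverts G" by blast
  qed
  then show ?thesis
    using surj_card_le[OF assms(1)] by (metis card_lessThan)
qed

lemma finite_b_coloring_numbers:
  assumes "finite (pverts G)"
  shows "finite {k. \<exists>c. b_coloring G k c}"
proof (rule finite_subset)
  show "{k. \<exists>c. b_coloring G k c} \<subseteq> {..card (pverts G)}"
    using b_coloring_card_le[OF assms] by blast
qed simp

lemma pair_graph_hamming_graph: "pair_graph (hamming_graph n q)"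
proof
  let ?V = "{..<n} \<rightarrow>\<^sub>E {..<q}"
  have fin: "finite ?V" by (rule finite_PiE) simp_all
  then show "finite (pverts (hamming_graph n q))"
    by (simp add: hamming_graph_def)
  have "parcs (hamming_graph n q) \<subseteq> ?V \<times> ?V"
    unfolding hamming_graph_def pair_pre_digraph.simps by blast
  then show "finite (parcs (hamming_graph n q))"
    by (rule finite_subset) (rule finite_cartesian_product[OF fin fin])
  show "symmetric (hamming_graph n q)"
  proof (unfold symmetric_def, rule symI)
    fix x y assume "(x, y) \<in> arcs_ends (with_proj (hamming_graph n q))"
    moreover have "{i. i < n \<and> x i \<noteq> y i} = {i. i < n \<and> y i \<noteq> x i}"
      by (rule Collect_cong) auto
    ultimately show "(y, x) \<in> arcs_ends (with_proj (hamming_graph n q))"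
      by (simp add: hamming_graph_def)
  qed
next
  fix e assume "e \<in> parcs (hamming_graph n q)"
  then show "fst e \<in> pverts (hamming_graph n q)" "snd e \<in> pverts (hamming_graph n q)"
    "fst e \<noteq> snd e"
    unfolding hamming_graph_def by (cases e; force)+
qed

lemma finite_verts_graph_power_hamming_graph:
  "finite (pverts (graph_power (hamming_graph n q) p))"
  using pair_graph.axioms(1)[OF pair_graph_hamming_graph, of n q]
  by (simp add: graph_power_def pair_digraph_def pair_fin_digraph_def pair_fin_digraph_axioms_def)

lemma hamming_graph_awalk_ge:
  assumes "pre_digraph.awalk (with_proj (hamming_graph n q)) x w y"
  shows "card {i. i < n \<and> x i \<noteq> y i} \<le> length w"
proof -
  interpret pair_graph "hamming_graph n q" by (rule pair_graph_hamming_graph)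
  show ?thesis using assms
  proof (induction w arbitrary: x)
    case Nil
    then show ?case by (simp add: awalk_Nil_iff)
  next
    case (Cons e w)
    then have e: "e \<in> parcs (hamming_graph n q)" "x = fst e" "awalk (snd e) w y"
      by (auto simp: awalk_Cons_iff)
    have 1: "card {i. i < n \<and> x i \<noteq> snd e i} = 1"
      using e(1,2) by (cases e) (simp add: hamming_graph_def)
    have "card {i. i < n \<and> x i \<noteq> y i}
        \<le> card ({i. i < n \<and> x i \<noteq> snd e i} \<union> {i. i < n \<and> snd e i \<noteq> y i})"
      by (rule card_mono) auto
    also have "\<dots> \<le> card {i. i < n \<and> x i \<noteq> snd e i} + card {i. i < n \<and> snd e i \<noteq> y i}"
      by (rule card_Un_le)
    also have "\<dots> \<le> length (e # w)"
      using 1 Cons.IH[OF e(3)] by simp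
    finally show ?case .
  qed
qed

lemma hamming_graph_awalk_exists:
  assumes "x \<in> {..<n} \<rightarrow>\<^sub>E {..<q}" "y \<in> {..<n} \<rightarrow>\<^sub>E {..<q}"
  shows "\<exists>w. pre_digraph.awalk (with_proj (hamming_graph n q)) x w y \<and>
             length w = card {i. i < n \<and> x i \<noteq> y i}"
proof -
  interpret pair_graph "hamming_graph n q" by (rule pair_graph_hamming_graph)
  have "\<exists>w. awalk x w y \<and> length w = card {i. i < n \<and> x i \<noteq> y i}"
    using assms(1)
  proof (induction "card {i. i < n \<and> x i \<noteq> y i}" arbitrary: x)
    case 0
    have "finite {i. i < n \<and> x i \<noteq> y i}" by simp
    with 0(1) have "{i. i < n \<and> x i \<noteq> y i} = {}" by (metis card_eq_0_iff)
    then have "\<forall>i<n. x i = y i" by blast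
    then have "x = y"
      by (intro PiE_ext[OF 0(2) assms(2)]) simp
    have "y \<in> pverts (hamming_graph n q)"
      using assms(2) by (simp add: hamming_graph_def)
    then have "awalk y [] y" by (simp add: awalk_Nil_iff)
    then show ?case
      using 0(1) unfolding \<open>x = y\<close> by (intro exI[of _ "[]"]) simp
  next
    case (Suc m)
    then obtain j where j: "j < n" "x j \<noteq> y j"
      by (metis (mono_tags, lifting) Collect_empty_eq card.empty nat.distinct(1))
    define z where "z = x(j := y j)"
    have yj: "y j < q" using assms(2) j by auto
    have z: "z \<in> {..<n} \<rightarrow>\<^sub>E {..<q}"
      using Suc.prems j yj unfolding z_def by (auto simp: PiE_iff extensional_def)
    have "{i. i < n \<and> x i \<noteq> z i} = {j}" using j by (auto simp: z_def)
    then have arc: "(x, z) \<in> parcs (hamming_graph n q)"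
      using Suc.prems z by (simp add: hamming_graph_def)
    have "{i. i < n \<and> z i \<noteq> y i} = {i. i < n \<and> x i \<noteq> y i} - {j}"
      by (auto simp: z_def)
    then have m: "m = card {i. i < n \<and> z i \<noteq> y i}"
      using Suc(2) j by simp
    from Suc.hyps(1)[OF m z] obtain w where "awalk z w y" "length w = m"
      using m by auto
    then have "awalk x ((x, z) # w) y \<and> length ((x, z) # w) = Suc m"
      using arc by (auto simp: awalk_Cons_iff)
    then show ?case using Suc(2) by metis
  qed
  then show ?thesis .
qed

lemma graph_dist_hamming_graph:
  assumes "x \<in> {..<n} \<rightarrow>\<^sub>E {..<q}" "y \<in> {..<n} \<rightarrow>\<^sub>E {..<q}"
  shows "graph_dist (hamming_graph n q) x y = ereal (real (card {i. i < n \<and> x i \<noteq> y i}))"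
proof -
  interpret pair_graph "hamming_graph n q" by (rule pair_graph_hamming_graph)
  have cost: "awalk_cost (\<lambda>_. 1) w = real (length w)" for w :: "((nat \<Rightarrow> nat) \<times> (nat \<Rightarrow> nat)) list"
    by (induction w) auto
  show ?thesis
    unfolding graph_dist_def \<mu>_def
  proof (rule antisym)
    obtain w where w: "awalk x w y" "length w = card {i. i < n \<and> x i \<noteq> y i}"
      using hamming_graph_awalk_exists[OF assms] by auto
    then show "(INF p\<in>{p. awalk x p y}. ereal (awalk_cost (\<lambda>_. 1) p))
        \<le> ereal (real (card {i. i < n \<and> x i \<noteq> y i}))"
      by (intro INF_lower2[of w]) (auto simp: cost)
    show "ereal (real (card {i. i < n \<and> x i \<noteq> y i}))
        \<le> (INF p\<in>{p. awalk x p y}. ereal (awalk_cost (\<lambda>_. 1) p))"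
      by (intro INF_greatest) (auto simp: cost dest: hamming_graph_awalk_ge)
  qed
qed

end

theory Submission
  imports Defs
begin

text \<open>
  Color the vertices by the cosets of the repetition code, the line spanned by \<open>(1, \<dots>, 1)\<close> in
  \<open>\<int>\<^sub>q\<^sup>n\<close>. Two points of one coset differ in all \<open>n > p\<close> coordinates, so the coloring is proper.
  Given a tuple \<open>u\<close> and another coset \<open>w + \<int>\<^sub>q (1, \<dots>, 1)\<close>, some residue \<open>t\<close> occurs at least
  \<open>n / q\<close> times among the differences \<open>u i - w i\<close>, so \<open>w + t (1, \<dots>, 1)\<close> is at distance at most
  \<open>\<lfloor>n (q - 1) / q\<rfloor> \<le> p\<close> from \<open>u\<close>. Thus every vertex sees every other color.
\<close>

text \<open>The differences to the last coordinate determine the coset of the repetition code.\<close>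

definition rep_coset :: "nat \<Rightarrow> nat \<Rightarrow> (nat \<Rightarrow> nat) \<Rightarrow> nat \<Rightarrow> nat" where
  "rep_coset m q x = (\<lambda>i\<in>{..<m}. nat ((int (x i) - int (x m)) mod int q))"

definition translate :: "nat \<Rightarrow> nat \<Rightarrow> nat \<Rightarrow> (nat \<Rightarrow> nat) \<Rightarrow> nat \<Rightarrow> nat" where
  "translate n q t x = (\<lambda>i\<in>{..<n}. (x i + t) mod q)"

lemma mem_arcs_graph_power_hamming_graph:
  "(x, y) \<in> parcs (graph_power (hamming_graph n q) p) \<longleftrightarrow>
     x \<in> {..<n} \<rightarrow>\<^sub>E {..<q} \<and> y \<in> {..<n} \<rightarrow>\<^sub>E {..<q} \<and> x \<noteq> y \<and>
     card {i. i < n \<and> x i \<noteq> y i} \<le> p"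
proof -
  have "pverts (hamming_graph n q) = {..<n} \<rightarrow>\<^sub>E {..<q}"
    by (simp add: hamming_graph_def)
  then show ?thesis
    by (simp add: graph_power_def graph_dist_hamming_graph cong: conj_cong)
qed

lemma rep_coset_in: "0 < q \<Longrightarrow> rep_coset m q x \<in> {..<m} \<rightarrow>\<^sub>E {..<q}"
  unfolding rep_coset_def by (rule restrict_PiE_iff[THEN iffD2]) (simp add: nat_less_iff)

lemma translate_in: "0 < q \<Longrightarrow> translate n q t x \<in> {..<n} \<rightarrow>\<^sub>E {..<q}"
  unfolding translate_def by (rule restrict_PiE_iff[THEN iffD2]) simp

text \<open>Undoes \<open>nat\<close> and adds coordinate \<open>m\<close>, where both differences
  vanish, so that later arguments treat all coordinates alike.\<close>

lemma rep_coset_eqD: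
  assumes "rep_coset m q x = rep_coset m q y" "0 < q" "i < Suc m"
  shows "(int (x i) - int (x m)) mod int q = (int (y i) - int (y m)) mod int q"
proof (cases "i = m")
  case False
  then have "i < m" using assms(3) by simp
  with fun_cong[OF assms(1), of i] assms(2) show ?thesis
    by (simp add: rep_coset_def nat_eq_iff)
qed simp

text \<open>Tuples with the same label differ by a constant modulo \<open>q\<close>, and one common
  coordinate forces this constant to be 0.\<close>

lemma rep_coset_eq_imp_eq:
  assumes x: "x \<in> {..<Suc m} \<rightarrow>\<^sub>E {..<q}" and y: "y \<in> {..<Suc m} \<rightarrow>\<^sub>E {..<q}"
    and eq: "rep_coset m q x = rep_coset m q y" and i: "i < Suc m" "x i = y i"
  shows "x = y"
proof (rule PiE_ext[OF x y])
  have lt: "x j < q" "y j < q" if "j < Suc m" for j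
    using x y that by auto
  have q: "0 < q" using lt(1)[of m] by simp
  have *: "int q dvd (int (x j) - int (x m)) - (int (y j) - int (y m))" if "j < Suc m" for j
    using rep_coset_eqD[OF eq q that] by (simp only: mod_eq_dvd_iff)
  fix j assume j: "j \<in> {..<Suc m}"
  \<comment> \<open>Subtracting the congruences for \<open>j\<close> and \<open>i\<close> cancels
    the reference coordinate \<open>m\<close>.\<close>
  have "int q dvd ((int (x j) - int (x m)) - (int (y j) - int (y m))) -
      ((int (x i) - int (x m)) - (int (y i) - int (y m)))"
    by (rule dvd_diff[OF *[of j] *[OF i(1)]]) (use j in simp)
  then have "int q dvd int (x j) - int (y j)"
    using i(2) by simp
  then have "int (x j) mod int q = int (y j) mod int q"
    by (simp only: mod_eq_dvd_iff)
  then show "x j = y j"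
    using lt[of j] j by simp
qed

text \<open>The common shift \<open>t\<close> cancels in the differences to coordinate
  \<open>m\<close>, so moving inside a coset keeps the color.\<close>

lemma rep_coset_translate: "rep_coset m q (translate (Suc m) q t x) = rep_coset m q x"
proof
  fix i
  have "(int ((x i + t) mod q) - int ((x m + t) mod q)) mod int q
      = (int (x i + t) - int (x m + t)) mod int q"
    by (simp only: zmod_int mod_diff_eq)
  then show "rep_coset m q (translate (Suc m) q t x) i = rep_coset m q x i"
    by (simp add: rep_coset_def translate_def del: of_nat_mod)
qed

lemma rep_coset_surj:
  assumes "a \<in> {..<m} \<rightarrow>\<^sub>E {..<q}" "0 < q"
  shows "\<exists>x \<in> {..<Suc m} \<rightarrow>\<^sub>E {..<q}. rep_coset m q x = a"
proof
  \<comment> \<open>With last entry 0, the differences to it are the entries of \<open>a\<close>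
    themselves.\<close>
  show "a(m := 0) \<in> {..<Suc m} \<rightarrow>\<^sub>E {..<q}"
    using assms by (auto simp: PiE_iff extensional_def less_Suc_eq)
  show "rep_coset m q (a(m := 0)) = a"
  proof (rule PiE_ext[OF rep_coset_in[OF assms(2)] assms(1)])
    fix i assume "i \<in> {..<m}"
    moreover have "a i < q" using assms(1) \<open>i \<in> {..<m}\<close> by auto
    ultimately show "rep_coset m q (a(m := 0)) i = a i"
      by (simp add: rep_coset_def)
  qed
qed

text \<open>In coding terms, the covering radius of the repetition code is at most
  \<open>p\<close>.\<close>

lemma ex_translate_close:
  assumes u: "u \<in> {..<n} \<rightarrow>\<^sub>E {..<q}" and q: "0 < q"
    and p: "\<lfloor>real (n * (q - 1)) / real q\<rfloor> \<le> int p"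
  shows "\<exists>t. card {i. i < n \<and> u i \<noteq> translate n q t w i} \<le> p"
proof -
  let ?g = "\<lambda>i. nat ((int (u i) - int (w i)) mod int q)"
  have "?g \<in> {..<n} \<rightarrow> {..<q}"
    using q by (auto simp: nat_less_iff)
  \<comment> \<open>The most frequent difference; the product form of the pigeonhole bound avoids
    rounding \<open>n / q\<close>.\<close>
  then obtain t where t: "n \<le> card (?g -` {t} \<inter> {..<n}) * q"
    using pigeonhole_card[of ?g "{..<n}" "{..<q}"] q by auto
  have eq: "u i = translate n q t w i" if "i < n" "?g i = t" for i
  proof -
    have "u i < q" using u that(1) by auto
    have "int t = (int (u i) - int (w i)) mod int q"
      using that(2) q by auto
    then have "int ((w i + t) mod q) = int (u i) mod int q"
      by (simp add: zmod_int mod_add_right_eq)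
    then show ?thesis
      using \<open>u i < q\<close> that(1) by (simp add: translate_def)
  qed
  let ?S = "?g -` {t} \<inter> {..<n}"
  have "{i. i < n \<and> u i \<noteq> translate n q t w i} \<subseteq> {..<n} - ?S"
    using eq by auto
  then have "card {i. i < n \<and> u i \<noteq> translate n q t w i} \<le> card ({..<n} - ?S)"
    by (intro card_mono) auto
  also have "\<dots> = n - card ?S"
    by (subst card_Diff_subset) auto
  also have "\<dots> \<le> p"
  proof -
    \<comment> \<open>Replacing the floor by a strict bound with \<open>p + 1\<close> allows
      clearing denominators. Adding \<open>n \<le> card ?S * q\<close> and cancelling
      \<open>q\<close> then gives \<open>n < p + 1 + card ?S\<close>.\<close>
    have "real (n * (q - 1)) / real q < real p + 1"
      using p by linarith
    then have "real (n * (q - 1)) < real ((p + 1) * q)"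
      using q by (simp add: field_simps)
    then have "n * (q - 1) < (p + 1) * q"
      by (simp only: of_nat_less_iff)
    then have "n * q < (p + 1 + card ?S) * q"
      using t by (simp add: algebra_simps diff_mult_distrib2)
    then have "n < p + 1 + card ?S"
      by (simp only: mult_less_cancel2)
    then show ?thesis by linarith
  qed
  finally show ?thesis by blast
qed

theorem theorem5p1:
  fixes n q p :: nat
  assumes "n > 0" and "q > 0" and "p > 0"
    and "2 \<le> q" and "q \<le> n - 1"
    and "\<lfloor>real (n * (q - 1)) / real q\<rfloor> \<le> int p" and "p \<le> n - 1"
  shows "b_chromatic_number (graph_power (hamming_graph n q) p) \<ge> q ^ (n - 1)"
proof -
  obtain m where n: "n = Suc m" using assms(1) by (cases n) auto
  let ?G = "graph_power (hamming_graph n q) p"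
  let ?A = "{..<m} \<rightarrow>\<^sub>E {..<q}"
  have verts: "pverts ?G = {..<Suc m} \<rightarrow>\<^sub>E {..<q}"
    by (simp add: graph_power_def hamming_graph_def n)
  have "finite ?A" "card ?A = q ^ m"
    by (simp_all add: finite_PiE card_PiE)
  \<comment> \<open>Colors must be numbers below \<open>q ^ m\<close>, so \<open>h\<close>
    enumerates the coset labels.\<close>
  then obtain h where h: "bij_betw h ?A {..<q ^ m}"
    using ex_bij_betw_finite_nat[of ?A] by (auto simp: lessThan_atLeast0)
  let ?c = "\<lambda>x. h (rep_coset m q x)"
  have inj: "?c x = ?c y \<longleftrightarrow> rep_coset m q x = rep_coset m q y" for x y
    using bij_betw_imp_inj_on[OF h] rep_coset_in[OF assms(2)] by (simp add: inj_on_eq_iff)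
  have proper: "proper_coloring ?G (q ^ m) ?c"
    unfolding proper_coloring_def
  proof (intro conjI ballI)
    show "?c \<in> pverts ?G \<rightarrow> {..<q ^ m}"
      using bij_betwE[OF h] rep_coset_in[OF assms(2)] by blast
    fix e assume "e \<in> parcs ?G"
    moreover obtain x y where e: "e = (x, y)" by (cases e)
    ultimately have xy: "x \<in> {..<Suc m} \<rightarrow>\<^sub>E {..<q}" "y \<in> {..<Suc m} \<rightarrow>\<^sub>E {..<q}" "x \<noteq> y"
      "card {i. i < Suc m \<and> x i \<noteq> y i} \<le> p"
      by (auto simp: mem_arcs_graph_power_hamming_graph n)
    \<comment> \<open>Adjacent tuples differ in at most \<open>p \<le> m\<close> of the
      \<open>Suc m\<close> coordinates.\<close>
    have "\<exists>i<Suc m. x i = y i"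
    proof (rule ccontr)
      assume "\<not> ?thesis"
      then have "{i. i < Suc m \<and> x i \<noteq> y i} = {..<Suc m}" by auto
      then show False using xy(4) assms(7) n by simp
    qed
    then show "case e of (x, y) \<Rightarrow> ?c x \<noteq> ?c y"
      using rep_coset_eq_imp_eq[OF xy(1,2)] xy(3) by (auto simp: e inj)
  qed
  have surj: "\<exists>x \<in> {..<Suc m} \<rightarrow>\<^sub>E {..<q}. ?c x = i" if "i < q ^ m" for i
    using rep_coset_surj[OF _ assms(2)] bij_betw_imp_surj_on[OF h] that
    by (metis (no_types, lifting) imageE lessThan_iff)
  have "b_coloring ?G (q ^ m) ?c"
    unfolding b_coloring_def
  proof (intro conjI proper allI impI)
    fix i assume "i < q ^ m"
    then obtain u where u: "u \<in> {..<Suc m} \<rightarrow>\<^sub>E {..<q}" "?c u = i"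
      using surj by blast
    have "\<exists>v. (u, v) \<in> parcs ?G \<and> ?c v = j" if j: "j < q ^ m" "j \<noteq> i" for j
    proof -
      obtain w where w: "?c w = j" using surj[OF j(1)] by blast
      obtain t where t: "card {i. i < n \<and> u i \<noteq> translate n q t w i} \<le> p"
        using ex_translate_close[of u n q p w] u(1) assms(2,6) n by blast
      have "?c (translate n q t w) = j"
        using w by (simp add: n rep_coset_translate)
      \<comment> \<open>Arcs of the power join distinct vertices only; here the colors
        \<open>i\<close> and \<open>j\<close> tell them apart.\<close>
      moreover from this have "u \<noteq> translate n q t w" using u(2) j(2) by blast
      ultimately show ?thesis
        using u(1) t translate_in[OF assms(2)]
        by (intro exI[of _ "translate n q t w"]) (simp add: mem_arcs_graph_power_hamming_graph n)
    qed
    then show "\<exists>u\<in>pverts ?G. ?c u = i \<and> (\<forall>j<q ^ m. j \<noteq> i \<longrightarrow> (\<exists>v. (u, v) \<in> parcs ?G \<and> ?c v = j))"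
      using u verts by blast
  qed
  then show ?thesis
    unfolding b_chromatic_number_def
    by (intro Max_ge finite_b_coloring_numbers finite_verts_graph_power_hamming_graph)
       (auto simp: n)
qed

end
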